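(* Let $n\ge2$, let $a\in C^{\beta}(\mathbb{R}^n)$ for some $\beta\in(0,1]$ with $a>0$ on $\mathbb{R}^n$, and let $\omega<-\frac14(n-2)^2$. There exists an $\epsilon>0$ such that the following holds. If $V\in C^{\beta}(\mathbb{R}^n-\{0\})$ is real-valued with $\liminf_{x\to0}V(x)>-\infty$ and $$V(x)\le\frac{\omega}{|x|^2}\quad\text{for }|x|>\epsilon,$$ then for every $p>1$ there are no global solutions to the problem $$u_t=\Delta u-Vu+au^p\ \text{ in }\mathbb{R}^n\times(0,T),\qquad u(x,0)=\phi(x)\ \text{ in }\mathbb{R}^n,$$ for any bounded continuous initial data $\phi\ge0$, $\phi\not\equiv0$.
   Context: The class $C^\beta$ means Hölder continuous with exponent $\beta$ (locally on the indicated set). Here $T\in(0,\infty]$. A solution on the time interval $(0,T)$ means a nonnegative classical solution $u$ satisfying $\|u(\cdot,t)\|_\infty<\infty$ for $0<t<T$. A solution is called global if $T=\infty$. *)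

theory Defs
  imports "HOL-Analysis.Analysis"
begin

definition locally_holder_on :: "real \<Rightarrow> 'a::metric_space set \<Rightarrow> ('a \<Rightarrow> real) \<Rightarrow> bool"
  where "locally_holder_on \<beta> S f \<longleftrightarrow>
    (\<forall>K. compact K \<and> K \<subseteq> S \<longrightarrow>
      (\<exists>C. \<forall>x\<in>K. \<forall>y\<in>K. \<bar>f x - f y\<bar> \<le> C * dist x y powr \<beta>))"

text \<open>
  The values of \<^term>\<open>deriv\<close> below are meaningful only where the corresponding
  derivatives exist; \<open>C21_on\<close> states this existence explicitly.
\<close>

definition partial :: "'n::finite \<Rightarrow> (real ^ 'n \<Rightarrow> real) \<Rightarrow> real ^ 'n \<Rightarrow> real"
  where "partial i f x = deriv (\<lambda>s. f (x + s *\<^sub>R axis i 1)) 0"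

definition has_partial :: "'n::finite \<Rightarrow> (real ^ 'n \<Rightarrow> real) \<Rightarrow> real ^ 'n \<Rightarrow> bool"
  where "has_partial i f x \<longleftrightarrow> (\<lambda>s. f (x + s *\<^sub>R axis i 1)) differentiable (at 0)"

definition laplacian :: "(real ^ 'n::finite \<Rightarrow> real) \<Rightarrow> real ^ 'n \<Rightarrow> real"
  where "laplacian f x = (\<Sum>i\<in>UNIV. partial i (partial i f) x)"

text \<open>The parabolic class \<open>C\<^sup>2\<^sup>,\<^sup>1\<close> on \<open>\<Omega> \<times> I\<close>, for open \<open>\<Omega>\<close> and \<open>I\<close>.\<close>

definition C21_on ::
    "(real ^ 'n::finite) set \<Rightarrow> real set \<Rightarrow> (real ^ 'n \<Rightarrow> real \<Rightarrow> real) \<Rightarrow> bool"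
  where "C21_on \<Omega> I u \<longleftrightarrow>
    (\<forall>x\<in>\<Omega>. \<forall>t\<in>I.
        u x differentiable (at t) \<and>
        (\<forall>i. has_partial i (\<lambda>y. u y t) x) \<and>
        (\<forall>i j. has_partial i (partial j (\<lambda>y. u y t)) x)) \<and>
    continuous_on (\<Omega> \<times> I) (\<lambda>(x, t). u x t) \<and>
    continuous_on (\<Omega> \<times> I) (\<lambda>(x, t). deriv (u x) t) \<and>
    (\<forall>i. continuous_on (\<Omega> \<times> I) (\<lambda>(x, t). partial i (\<lambda>y. u y t) x)) \<and>
    (\<forall>i j. continuous_on (\<Omega> \<times> I) (\<lambda>(x, t). partial i (partial j (\<lambda>y. u y t)) x))"

text \<open>
  Solutions of \<open>u\<^sub>t = \<Delta>u - V u + a u\<^sup>p\<close> with \<open>u(\<cdot>, 0) = \<phi>\<close> on the time interval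
  \<open>(0, T)\<close>. The potential \<open>V\<close> is given only on \<open>\<real>\<^sup>n - {0}\<close> (its value at \<open>0\<close> is
  never used), so the equation and the regularity of \<open>u\<close> are imposed for \<open>x \<noteq> 0\<close>;
  no regularity at \<open>x = 0\<close> is assumed, which is the most inclusive notion of a
  classical solution for such \<open>V\<close>.
\<close>

definition classical_solution ::
    "(real ^ 'n::finite \<Rightarrow> real) \<Rightarrow> (real ^ 'n \<Rightarrow> real) \<Rightarrow> real \<Rightarrow> (real ^ 'n \<Rightarrow> real) \<Rightarrow>
      ereal \<Rightarrow> (real ^ 'n \<Rightarrow> real \<Rightarrow> real) \<Rightarrow> bool"
  where "classical_solution V a p \<phi> T u \<longleftrightarrow>
    0 < T \<and>
    (\<forall>x t. 0 \<le> t \<and> ereal t < T \<longrightarrow> 0 \<le> u x t) \<and>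
    continuous_on ((- {0}) \<times> {t. 0 \<le> t \<and> ereal t < T}) (\<lambda>(x, t). u x t) \<and>
    C21_on (- {0}) {t. 0 < t \<and> ereal t < T} u \<and>
    (\<forall>t. 0 < t \<and> ereal t < T \<longrightarrow> bounded (range (\<lambda>x. u x t))) \<and>
    (\<forall>x t. x \<noteq> 0 \<and> 0 < t \<and> ereal t < T \<longrightarrow>
        deriv (u x) t = laplacian (\<lambda>y. u y t) x - V x * u x t + a x * u x t powr p) \<and>
    (\<forall>x. u x 0 = \<phi> x)"

definition global_solution ::
    "(real ^ 'n::finite \<Rightarrow> real) \<Rightarrow> (real ^ 'n \<Rightarrow> real) \<Rightarrow> real \<Rightarrow> (real ^ 'n \<Rightarrow> real) \<Rightarrow>
      (real ^ 'n \<Rightarrow> real \<Rightarrow> real) \<Rightarrow> bool"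
  where "global_solution V a p \<phi> u \<longleftrightarrow> classical_solution V a p \<phi> \<infinity> u"

end

theory Submission
  imports Defs
begin

text \<open>
  The argument uses only the parabolic maximum principle on compact sets avoiding the origin, so
  the behaviour of \<open>u\<close> at \<open>0\<close> and at infinity does not matter. A strict subsolution with compact
  support travelling along a segment spreads positivity from one point to all of \<open>\<real>\<^sup>n - {0}\<close>.
  Since \<open>\<omega> < -(1/4)(n - 2)\<^sup>2\<close>, for small \<open>\<kappa>\<close> the function \<open>\<psi>(x) = r\<^sup>-\<^sup>\<mu> sin (\<kappa> ln (r/4))\<close> with
  \<open>r = |x|\<^sup>2\<close> and \<open>\<mu> = (n - 2)/4\<close> is positive in an annulus outside the unit ball, vanishes on its
  boundary, and satisfies \<open>\<Delta>\<psi> - V\<psi> \<ge> \<delta>\<psi>\<close> there with \<open>\<delta> > 0\<close>; hence \<open>u\<close> grows exponentially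
  inside the annulus. Once \<open>u\<close> is large on a ball around \<open>y\<close> for all later times, it dominates
  there the subsolution with power \<open>-1/(p - 1)\<close> of \<open>\<alpha> - \<beta>t + \<gamma>|x - y|\<^sup>2\<close>, which becomes infinite
  at \<open>y\<close> in finite time.
\<close>

section \<open>Parabolic comparison through first contact points\<close>

text \<open>The points of \<open>Q\<close> with \<open>w \<le> 0\<close> form a compact set, so one
  of them has least time. Hypothesis \<open>nb\<close> replaces sign conditions on the parabolic
  boundary: a point with \<open>w \<le> 0\<close> has a backward cylinder inside \<open>Q\<close>,
  hence is neither initial nor lateral. In that cylinder \<open>w > 0\<close> before time
  \<open>t\<close>, and continuity in time gives \<open>w \<ge> 0\<close> on the slice at
  \<open>t\<close>, so \<open>w\<close> vanishes at the contact point.\<close>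

lemma first_contact:
  fixes w :: "'a::metric_space \<Rightarrow> real \<Rightarrow> real"
  assumes Q: "compact Q" and cont: "continuous_on Q (\<lambda>(x, t). w x t)"
    and nb: "\<And>x t. (x, t) \<in> Q \<Longrightarrow> w x t \<le> 0 \<Longrightarrow>
      \<exists>e>0. \<forall>y s. dist y x < e \<and> t - e < s \<and> s \<le> t \<longrightarrow> (y, s) \<in> Q"
    and start: "(x0, s0) \<in> Q" "w x0 s0 \<le> 0"
  obtains x t e where "(x, t) \<in> Q" "0 < e" "w x t = 0"
    "\<And>y. dist y x < e \<Longrightarrow> 0 \<le> w y t" "\<And>s. t - e < s \<Longrightarrow> s < t \<Longrightarrow> 0 < w x s"
    "\<And>y s. dist y x < e \<Longrightarrow> t - e < s \<Longrightarrow> s \<le> t \<Longrightarrow> (y, s) \<in> Q"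
proof -
  define Z where "Z = {z \<in> Q. (\<lambda>(x, t). w x t) z \<le> 0}"
  have "closedin (top_of_set Q) {z \<in> Q. (\<lambda>(x, t). w x t) z \<in> {..0}}"
    by (rule continuous_closedin_preimage_gen[OF cont, of UNIV, unfolded vimage_def Int_def, simplified])
      (simp_all)
  then have "closedin (top_of_set Q) Z" by (simp add: Z_def)
  then have "compact Z" using Q closedin_compact by blast
  moreover have "Z \<noteq> {}" using start by (auto simp: Z_def)
  moreover have "continuous_on Z snd" by (intro continuous_intros)
  ultimately obtain z where z: "z \<in> Z" "\<And>z'. z' \<in> Z \<Longrightarrow> snd z \<le> snd z'"
    using continuous_attains_inf[of Z snd] by blast
  obtain x t where zz: "z = (x, t)" by force
  have xt: "(x, t) \<in> Q" "w x t \<le> 0" using z zz by (auto simp: Z_def)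
  obtain e where e: "e > 0" "\<And>y s. dist y x < e \<Longrightarrow> t - e < s \<Longrightarrow> s \<le> t \<Longrightarrow> (y, s) \<in> Q"
    using nb[OF xt] by blast
  have pos: "0 < w y s" if "dist y x < e" "t - e < s" "s < t" for y s
    using z(2)[of "(y, s)"] e(2)[of y s] that zz by (force simp: Z_def)
  have nonneg: "0 \<le> w y t" if y: "dist y x < e" for y
  proof -
    have "continuous_on {t - e / 2..t} (\<lambda>s. (\<lambda>(x, t). w x t) (y, s))"
      by (rule continuous_on_compose2[OF cont]) (use e(1) in \<open>auto intro!: continuous_intros e(2) y\<close>)
    then have "((\<lambda>s. w y s) \<longlongrightarrow> w y t) (at t within {t - e / 2..t})"
      using e(1) by (auto simp: continuous_on_def)
    then have lim: "((\<lambda>s. w y s) \<longlongrightarrow> w y t) (at_left t)"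
      using e(1) by (simp add: at_within_Icc_at_left)
    have "\<forall>\<^sub>F s in at_left t. 0 \<le> w y s"
      using eventually_at_left_real[of "t - e" t] e(1)
      by (auto elim!: eventually_mono simp: less_imp_le pos y)
    then show ?thesis using tendsto_lowerbound[OF lim] by simp
  qed
  show ?thesis
    using that[OF xt(1) e(1)] nonneg pos e xt by (metis dist_self order_antisym)
qed

text \<open>If \<open>d < 0\<close>, then \<open>f'\<close> drops below \<open>f' 0 = 0\<close> just
  to the right of 0, and the mean value theorem gives \<open>f h < f 0\<close>. The second
  derivative is required at the single point 0.\<close>

lemma second_derivative_local_min_nonneg:
  fixes f f' :: "real \<Rightarrow> real"
  assumes e: "0 < e" and f: "\<And>s. \<bar>s\<bar> < e \<Longrightarrow> (f has_real_derivative f' s) (at s)"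
    and f': "(f' has_real_derivative d) (at 0)"
    and min: "\<And>s. \<bar>s\<bar> < e \<Longrightarrow> f 0 \<le> f s"
  shows "0 \<le> d"
proof (rule ccontr)
  assume "\<not> 0 \<le> d"
  moreover have f'0: "f' 0 = 0"
    using DERIV_local_min[OF f[of 0] e] min e by (simp add: abs_minus_commute)
  ultimately obtain k where k: "k > 0" "\<And>h. 0 < h \<Longrightarrow> h < k \<Longrightarrow> f' h < 0"
    using DERIV_neg_dec_right[OF f'] by auto
  define h where "h = min e k / 2"
  have h: "0 < h" "h < e" "h < k" using e k by (auto simp: h_def min_def)
  obtain z where z: "0 < z" "z < h" "f h - f 0 = (h - 0) * f' z"
    using MVT2[of 0 h f f'] f h by force
  then have "f h - f 0 < 0" using h k(2)[of z] by (simp add: mult_pos_neg)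
  then show False using min[of h] h by simp
qed

lemma norm_axis_shift:
  fixes z :: "real ^ 'n::finite"
  shows "(norm (z + s *\<^sub>R axis i 1))\<^sup>2 = (norm z)\<^sup>2 + 2 * s * z $ i + s\<^sup>2"
proof -
  have "axis i (1::real) \<bullet> axis i 1 = 1" by (simp add: inner_axis)
  then show ?thesis
    unfolding power2_norm_eq_inner
    by (simp add: inner_left_distrib inner_right_distrib inner_axis inner_axis' power2_eq_square algebra_simps)
qed

text \<open>\<open>partial\<close> differentiates at parameter 0 only; translating the parameter
  turns it into the derivative of one fixed line restriction at every \<open>s\<close>, as the
  one-variable minimum test needs.\<close>

lemma partial_deriv_along_axis:
  assumes "has_partial i f (x + s *\<^sub>R axis i 1)"
  shows "((\<lambda>r. f (x + r *\<^sub>R axis i 1)) has_real_derivative partial i f (x + s *\<^sub>R axis i 1)) (at s)"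
proof -
  let ?g = "\<lambda>r. f (x + r *\<^sub>R axis i 1)"
  have "((\<lambda>r. f (x + s *\<^sub>R axis i 1 + r *\<^sub>R axis i 1)) has_real_derivative
      partial i f (x + s *\<^sub>R axis i 1)) (at 0)"
    using assms unfolding has_partial_def partial_def
    by (metis DERIV_deriv_iff_real_differentiable)
  also have "(\<lambda>r. f (x + s *\<^sub>R axis i 1 + r *\<^sub>R axis i 1)) = (\<lambda>r. ?g (r + s))"
    by (simp add: algebra_simps)
  finally show ?thesis using DERIV_shift[of ?g _ 0 s] by simp
qed

text \<open>
  The Laplacian of \<open>G(|x - y|\<^sup>2)\<close> is \<open>4rG''(r) + 2nG'(r)\<close> at \<open>r = |x - y|\<^sup>2\<close>. The strict inequality
  is needed only where \<open>v = u\<close>, so no sign of \<open>V\<close> is required.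
\<close>

lemma comparison:
  fixes u v :: "real ^ 'n::finite \<Rightarrow> real \<Rightarrow> real" and y :: "real \<Rightarrow> real ^ 'n"
  assumes sol: "global_solution V a p \<phi> u"
    and Q: "compact Q" "Q \<subseteq> (- {0}) \<times> {0..}"
    and cont: "continuous_on Q (\<lambda>(x, t). v x t)"
    and nb: "\<And>x t. (x, t) \<in> Q \<Longrightarrow> u x t \<le> v x t \<Longrightarrow>
      \<exists>e>0. \<forall>y s. dist y x < e \<and> t - e < s \<and> s \<le> t \<longrightarrow> (y, s) \<in> Q"
    and v: "\<And>x t. v x t = G t ((norm (x - y t))\<^sup>2)"
    and G': "\<And>x t. (x, t) \<in> Q \<Longrightarrow>
      (G t has_real_derivative G' t ((norm (x - y t))\<^sup>2)) (at ((norm (x - y t))\<^sup>2))"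
    and G'': "\<And>x t. (x, t) \<in> Q \<Longrightarrow>
      (G' t has_real_derivative G'' t ((norm (x - y t))\<^sup>2)) (at ((norm (x - y t))\<^sup>2))"
    and vt: "\<And>x t. (x, t) \<in> Q \<Longrightarrow> (v x has_real_derivative vt x t) (at t)"
    and sub: "\<And>x t. (x, t) \<in> Q \<Longrightarrow> v x t = u x t \<Longrightarrow>
      vt x t < 4 * (norm (x - y t))\<^sup>2 * G'' t ((norm (x - y t))\<^sup>2)
        + 2 * real CARD('n) * G' t ((norm (x - y t))\<^sup>2) - V x * v x t + a x * v x t powr p"
    and mem: "(x1, t1) \<in> Q"
  shows "v x1 t1 < u x1 t1"
proof (rule ccontr)
  assume "\<not> v x1 t1 < u x1 t1"
  then have neg: "u x1 t1 - v x1 t1 \<le> 0" by simp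
  have C: "continuous_on ((- {0}) \<times> {0..}) (\<lambda>(x, t). u x t)"
    and C21: "C21_on (- {0}) {0<..} u"
    and pde: "\<And>x t. x \<noteq> 0 \<Longrightarrow> 0 < t \<Longrightarrow>
        deriv (u x) t = laplacian (\<lambda>y. u y t) x - V x * u x t + a x * u x t powr p"
    using sol unfolding global_solution_def classical_solution_def atLeast_def greaterThan_def by simp_all
  have "continuous_on Q (\<lambda>z. (\<lambda>(x, t). u x t) z - (\<lambda>(x, t). v x t) z)"
    by (intro continuous_on_diff cont continuous_on_subset[OF C Q(2)])
  then have cw: "continuous_on Q (\<lambda>(x, t). u x t - v x t)" by (simp add: case_prod_beta)
  obtain x t e where xt: "(x, t) \<in> Q" and e: "0 < e" and eq: "u x t - v x t = 0"
    and min: "\<And>y. dist y x < e \<Longrightarrow> 0 \<le> u y t - v y t"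
    and left: "\<And>s. t - e < s \<Longrightarrow> s < t \<Longrightarrow> 0 < u x s - v x s"
    and inQ: "\<And>y s. dist y x < e \<Longrightarrow> t - e < s \<Longrightarrow> s \<le> t \<Longrightarrow> (y, s) \<in> Q"
    using first_contact[OF Q(1) cw _ mem neg] nb by (smt (verit, best))
  \<comment> \<open>The backward neighbourhood lies in \<open>Q\<close>, hence in times at least 0;
    this makes the contact time strictly positive, so the differential equation holds there.\<close>
  have "(x, t - e / 2) \<in> Q" using inQ[of x "t - e / 2"] e by simp
  then have t: "0 < t" using Q(2) e by auto
  have ball: "z \<noteq> 0" if "dist z x < e" for z using inQ[OF that, of t] e Q(2) by auto
  have x: "x \<noteq> 0" using ball[of x] e by simp
  have ut: "u x differentiable (at t)"
    and up: "\<And>i z. z \<noteq> 0 \<Longrightarrow> has_partial i (\<lambda>y. u y t) z"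
    and upp: "\<And>i. has_partial i (partial i (\<lambda>y. u y t)) x"
    using C21 x t unfolding C21_on_def by auto
  have D: "((\<lambda>s. u x s - v x s) has_real_derivative deriv (u x) t - vt x t) (at t)"
    by (intro DERIV_diff vt[OF xt]) (metis ut DERIV_deriv_iff_real_differentiable)
  \<comment> \<open>\<open>u - v\<close> is positive just before \<open>t\<close> and zero at
    \<open>t\<close>, so its time derivative cannot be positive.\<close>
  have time: "deriv (u x) t \<le> vt x t"
  proof (rule ccontr)
    assume "\<not> ?thesis"
    then obtain d where d: "d > 0" "\<And>h. 0 < h \<Longrightarrow> h < d \<Longrightarrow> u x (t - h) - v x (t - h) < 0"
      using DERIV_pos_inc_left[OF D] eq by auto
    obtain h where "0 < h" "h < min d e" using dense[of 0 "min d e"] d(1) e by auto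
    then show False using d(2)[of h] left[of "t - h"] by simp
  qed
  define c where "c = y t"
  define r where "r = (norm (x - c))\<^sup>2"
  \<comment> \<open>The left side is the second derivative of \<open>v\<close> along axis
    \<open>i\<close>; on that line \<open>u - v\<close> has a minimum at the contact point.\<close>
  have second: "4 * ((x - c) $ i)\<^sup>2 * G'' t r + 2 * G' t r \<le> partial i (partial i (\<lambda>y. u y t)) x" for i
  proof -
    let ?l = "\<lambda>s. x + s *\<^sub>R axis i 1 :: real ^ 'n"
    let ?q = "\<lambda>s. r + 2 * s * (x - c) $ i + s\<^sup>2"
    have q: "(norm (?l s - c))\<^sup>2 = ?q s" for s
      using norm_axis_shift[of "x - c" s i] by (simp add: r_def algebra_simps)
    have dist: "dist (?l s) x = \<bar>s\<bar>" for s by (simp add: dist_norm norm_axis_1)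
    have vq: "v (?l s) t = G t (?q s)" for s unfolding v c_def[symmetric] q ..
    have "0 \<le> partial i (partial i (\<lambda>y. u y t)) x - (4 * ((x - c) $ i)\<^sup>2 * G'' t r + 2 * G' t r)"
    proof (rule second_derivative_local_min_nonneg[OF e])
      fix s :: real assume s: "\<bar>s\<bar> < e"
      have lq: "(?l s, t) \<in> Q" using inQ[of "?l s" t] s e by (simp add: dist)
      have "((\<lambda>s. G t (?q s)) has_real_derivative G' t (?q s) * (2 * (x - c) $ i + 2 * s)) (at s)"
        by (rule DERIV_chain2[where f = "G t" and g = ?q])
          (use G'[OF lq] in \<open>auto simp: c_def[symmetric] q intro!: derivative_eq_intros\<close>)
      then show "((\<lambda>s. u (?l s) t - v (?l s) t) has_real_derivative
          partial i (\<lambda>y. u y t) (?l s) - G' t (?q s) * (2 * (x - c) $ i + 2 * s)) (at s)"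
        unfolding vq
        by (intro DERIV_diff partial_deriv_along_axis[of i "\<lambda>y. u y t"] up)
          (use ball[of "?l s"] s dist in auto)
      show "u (?l 0) t - v (?l 0) t \<le> u (?l s) t - v (?l s) t"
        using min[of "?l s"] s dist eq by simp
    next
      have contact_G': "(G' t has_real_derivative G'' t r) (at (?q 0))"
        using G''[OF xt] by (simp add: c_def[symmetric] r_def)
      have "((\<lambda>s. G' t (?q s)) has_real_derivative G'' t r * (2 * (x - c) $ i)) (at 0)"
        by (rule DERIV_chain2[where f = "G' t" and g = ?q, OF contact_G']) (auto intro!: derivative_eq_intros)
      then have "((\<lambda>s. G' t (?q s) * (2 * (x - c) $ i + 2 * s)) has_real_derivative
          4 * ((x - c) $ i)\<^sup>2 * G'' t r + 2 * G' t r) (at 0)"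
        by (rule DERIV_cong[OF DERIV_mult[where Db = 2]])
          (auto intro!: derivative_eq_intros simp: power2_eq_square algebra_simps)
      then show "((\<lambda>s. partial i (\<lambda>y. u y t) (?l s) - G' t (?q s) * (2 * (x - c) $ i + 2 * s))
          has_real_derivative partial i (partial i (\<lambda>y. u y t)) x
            - (4 * ((x - c) $ i)\<^sup>2 * G'' t r + 2 * G' t r)) (at 0)"
        using partial_deriv_along_axis[of i "partial i (\<lambda>y. u y t)" x 0] upp
        by (intro DERIV_diff) auto
    qed
    then show ?thesis by simp
  qed
  have "4 * r * G'' t r + 2 * real CARD('n) * G' t r
      = (\<Sum>i\<in>UNIV. 4 * ((x - c) $ i)\<^sup>2 * G'' t r + 2 * G' t r)"
  proof -
    have "r = (\<Sum>i\<in>UNIV. ((x - c) $ i)\<^sup>2)"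
      unfolding r_def power2_norm_eq_inner inner_vec_def by (simp add: power2_eq_square)
    then have "(\<Sum>i\<in>UNIV. 4 * ((x - c) $ i)\<^sup>2 * G'' t r) = 4 * r * G'' t r"
      by (simp flip: sum_distrib_right sum_distrib_left)
    then show ?thesis by (simp add: sum.distrib)
  qed
  also have "\<dots> \<le> laplacian (\<lambda>y. u y t) x"
    unfolding laplacian_def by (intro sum_mono second)
  \<comment> \<open>Since \<open>v = u\<close> at contact, the lower-order terms agree. The strict
    inequality \<open>sub\<close>, the bound on the Laplacian and the equation give
    \<open>vt x t < deriv (u x) t\<close>, contradicting \<open>time\<close>.\<close>
  finally show False
    using sub[OF xt] eq time pde[OF x t] by (simp add: c_def r_def)
qed

section \<open>Continuity of the coefficients and of solutions\<close>

lemma locally_holder_on_imp_continuous_on: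
  assumes f: "locally_holder_on \<beta> S f" and \<beta>: "0 < \<beta>" and K: "compact K" "K \<subseteq> S"
  shows "continuous_on K f"
  unfolding continuous_on_def
proof
  fix x assume x: "x \<in> K"
  obtain C where C: "\<And>x y. x \<in> K \<Longrightarrow> y \<in> K \<Longrightarrow> \<bar>f x - f y\<bar> \<le> C * dist x y powr \<beta>"
    using f[unfolded locally_holder_on_def, rule_format, OF conjI[OF K]] by blast
  have "((\<lambda>y. dist y x) \<longlongrightarrow> 0) (at x within K)"
    using tendsto_dist[OF tendsto_ident_at tendsto_const, of x x K] by simp
  then have "((\<lambda>y. dist y x powr \<beta>) \<longlongrightarrow> 0) (at x within K)"
    by (rule tendsto_zero_powrI[OF _ tendsto_const]) (use \<beta> in auto)
  then have "((\<lambda>y. C * dist y x powr \<beta>) \<longlongrightarrow> 0) (at x within K)"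
    by (rule tendsto_mult_right_zero)
  then have "((\<lambda>y. f y - f x) \<longlongrightarrow> 0) (at x within K)"
    by (rule Lim_null_comparison[rotated]) (use C x in \<open>auto simp: eventually_at_filter\<close>)
  then show "(f \<longlongrightarrow> f x) (at x within K)" by (rule LIM_zero_cancel)
qed

lemma global_solutionD:
  assumes "global_solution V a p \<phi> u"
  shows "continuous_on ((- {0}) \<times> {0..}) (\<lambda>(x, t). u x t)"
    and "\<And>x t. 0 \<le> t \<Longrightarrow> 0 \<le> u x t" and "\<And>x. u x 0 = \<phi> x"
  using assms unfolding global_solution_def classical_solution_def atLeast_def by simp_all

lemma global_solution_continuous_on_slice:
  assumes "global_solution V a p \<phi> u" "0 \<le> t"
  shows "continuous_on (- {0}) (\<lambda>x. u x t)"
proof -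
  have "continuous_on (- {0}) (\<lambda>x. (\<lambda>(x, t). u x t) (x, t))"
    by (rule continuous_on_compose2[OF global_solutionD(1)[OF assms(1)]])
      (use assms(2) in \<open>auto intro!: continuous_intros\<close>)
  then show ?thesis by simp
qed

section \<open>Spreading of positivity\<close>

text \<open>The comparison function is a bump on a ball whose centre moves from \<open>x0\<close> to
  \<open>x1\<close>, lowered by a constant \<open>\<delta>\<close>. The lowering makes it negative
  on the edge of the ball, where it therefore cannot touch the nonnegative \<open>u\<close>; the
  decay of its amplitude absorbs the motion and the potential. At \<open>(x1, t1)\<close> it is
  exactly 0, and strict comparison yields positivity.\<close>

lemma positivity_along_segment:
  fixes u :: "real ^ 'n::finite \<Rightarrow> real \<Rightarrow> real"
  assumes sol: "global_solution V a p \<phi> u"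
    and V: "\<And>K. compact K \<Longrightarrow> K \<subseteq> - {0} \<Longrightarrow> continuous_on K V"
    and a: "\<And>x. 0 < a x"
    and t01: "0 \<le> t0" "t0 < t1" and pos: "0 < u x0 t0"
    and seg: "0 \<notin> closed_segment x0 x1"
  shows "0 < u x1 t1"
proof -
  have x0: "x0 \<noteq> 0" using seg by auto
  define m where "m = u x0 t0 / 2"
  have m: "0 < m" "m < u x0 t0" using pos by (auto simp: m_def)
  have "((\<lambda>x. u x t0) \<longlongrightarrow> u x0 t0) (at x0)"
    using global_solution_continuous_on_slice[OF sol t01(1)] x0
    by (simp add: continuous_on_eq_continuous_at open_Compl isCont_def)
  from order_tendstoD(1)[OF this m(2)] obtain d1 where
    d1: "d1 > 0" "\<And>x. dist x x0 < d1 \<Longrightarrow> m < u x t0"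
    unfolding eventually_at using m(2) by (metis UNIV_I)
  obtain d where d: "d > 0" "\<And>x. x \<in> closed_segment x0 x1 \<Longrightarrow> d \<le> dist 0 x"
    using separate_point_closed[OF closed_segment seg] by blast
  \<comment> \<open>Being below \<open>d1\<close> keeps \<open>u\<close> above \<open>m\<close> on
    the initial ball; being below \<open>d\<close> keeps the moving ball away from the
    origin.\<close>
  define \<rho> where "\<rho> = min d1 d / 2"
  have \<rho>: "0 < \<rho>" "\<rho> < d1" "\<rho> < d" using d d1 by (auto simp: \<rho>_def min_def)
  define K where "K = (\<lambda>z. fst z + snd z) ` (closed_segment x0 x1 \<times> cball 0 \<rho>)"
  have cK: "compact K" unfolding K_def
    by (intro compact_continuous_image compact_Times continuous_intros) auto
  have K0: "K \<subseteq> - {0}"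
  proof
    fix z assume "z \<in> K"
    then obtain p q where "p \<in> closed_segment x0 x1" "norm q \<le> \<rho>" "z = p + q"
      by (auto simp: K_def)
    then show "z \<in> - {0}" using d(2)[of p] \<rho> norm_diff_ineq[of p q] by auto
  qed
  then have "bounded (V ` K)"
    by (intro compact_imp_bounded compact_continuous_image V cK)
  then obtain M where M: "0 < M" "\<And>x. x \<in> K \<Longrightarrow> V x \<le> M"
    by (auto simp: bounded_pos abs_le_iff)
  define w where "w = (1 / (t1 - t0)) *\<^sub>R (x1 - x0)"
  define y where "y = (\<lambda>t. x0 + (t - t0) *\<^sub>R w)"
  have y: "y t \<in> closed_segment x0 x1" if "t0 \<le> t" "t \<le> t1" for t
  proof -
    have "y t = (1 - (t - t0) / (t1 - t0)) *\<^sub>R x0 + ((t - t0) / (t1 - t0)) *\<^sub>R x1"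
      by (simp add: y_def w_def algebra_simps)
    then show ?thesis unfolding closed_segment_def using that t01
      by (auto intro!: exI[of _ "(t - t0) / (t1 - t0)"])
  qed
  have y1: "y t1 = x1" and y0: "y t0 = x0" using t01 by (simp_all add: y_def w_def)
  define Q where "Q = (K \<times> {t0..t1}) \<inter> {z. norm (fst z - y (snd z)) \<le> \<rho>}"
  have Q: "(x, t) \<in> Q \<longleftrightarrow> t0 \<le> t \<and> t \<le> t1 \<and> norm (x - y t) \<le> \<rho>" for x t
  proof -
    have "x \<in> K" if "t0 \<le> t" "t \<le> t1" "norm (x - y t) \<le> \<rho>"
      unfolding K_def using y[OF that(1,2)] that(3) by (intro image_eqI[of _ _ "(y t, x - y t)"]) auto
    then show ?thesis by (auto simp: Q_def)
  qed
  have cQ: "compact Q" unfolding Q_def y_def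
    by (intro compact_Int_closed compact_Times cK compact_Icc closed_Collect_le continuous_intros)
  have QK: "x \<in> K" if "(x, t) \<in> Q" for x t using that by (auto simp: Q_def)
  define N where "N = real CARD('n)"
  \<comment> \<open>This collects the terms linear in \<open>s\<close>: the first comes from the
    moving centre, 8 from rewriting \<open>8 * r\<close> as \<open>8 * \<rho>^2 - 8 * s\<close>, and
    \<open>4 * N\<close> from the first-derivative part of the Laplacian.\<close>
  define D where "D = 4 * \<rho> * norm w + 8 + 4 * N"
  \<comment> \<open>large enough that the quadratic \<open>-(k - M)s\<^sup>2 + Ds - 8\<rho>\<^sup>2\<close> in \<open>s = \<rho>\<^sup>2 - |x - y t|\<^sup>2\<close> is negative\<close>
  define k where "k = M + (D / (4 * \<rho>))\<^sup>2"
  \<comment> \<open>Normalised so that the bump has height \<open>m\<close> at time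
    \<open>t0\<close>; \<open>\<delta>\<close> is its height at time \<open>t1\<close>.\<close>
  define C where "C = (\<lambda>t. m / (\<rho>\<^sup>2)\<^sup>2 * exp (- k * (t - t0)))"
  define \<delta> where "\<delta> = C t1 * (\<rho>\<^sup>2)\<^sup>2"
  have C: "0 < C t" for t using m \<rho> by (simp add: C_def)
  have \<delta>: "0 < \<delta>" using C[of t1] \<rho> by (simp add: \<delta>_def)
  \<comment> \<open>Because of the square, the Laplacian at the edge \<open>r = \<rho>^2\<close> is
    \<open>8 * \<rho>^2 * C t\<close>, still positive where the decay of \<open>C\<close>
    contributes nothing.\<close>
  define G where "G = (\<lambda>t r. C t * (\<rho>\<^sup>2 - r)\<^sup>2 - \<delta>)"
  define v where "v = (\<lambda>x t. G t ((norm (x - y t))\<^sup>2))"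
  define vt where "vt = (\<lambda>x t. C t * (- k * (\<rho>\<^sup>2 - (norm (x - y t))\<^sup>2)\<^sup>2
      + 4 * (\<rho>\<^sup>2 - (norm (x - y t))\<^sup>2) * ((x - y t) \<bullet> w)))"
  have "v x1 t1 < u x1 t1"
  proof (rule comparison[OF sol cQ, where G = G and y = y and vt = vt
        and G' = "\<lambda>t r. - 2 * C t * (\<rho>\<^sup>2 - r)" and G'' = "\<lambda>t r. 2 * C t"])
    show "Q \<subseteq> (- {0}) \<times> {0..}" using K0 t01 by (auto simp: Q_def)
    show "continuous_on Q (\<lambda>(x, t). v x t)"
      unfolding v_def G_def C_def y_def case_prod_beta by (intro continuous_intros)
    show "v x t = G t ((norm (x - y t))\<^sup>2)" for x t by (simp add: v_def)
    show "(x1, t1) \<in> Q" using t01 \<rho> by (simp add: Q y1)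
  next
    fix x t assume xt: "(x, t) \<in> Q" and le: "u x t \<le> v x t"
    have "0 \<le> v x t" using global_solutionD(2)[OF sol, of t x] le xt t01 by (simp add: Q)
    then have "norm (x - y t) \<noteq> \<rho>" using \<delta> by (auto simp: v_def G_def)
    then have n: "norm (x - y t) < \<rho>" using xt by (simp add: Q)
    have "t \<noteq> t0"
    proof
      assume t: "t = t0"
      have "(\<rho>\<^sup>2 - (norm (x - y t))\<^sup>2)\<^sup>2 \<le> (\<rho>\<^sup>2)\<^sup>2"
        using power_mono[OF less_imp_le[OF n] norm_ge_zero, of 2] by (intro power_mono) auto
      then have "C t * (\<rho>\<^sup>2 - (norm (x - y t))\<^sup>2)\<^sup>2 \<le> C t * (\<rho>\<^sup>2)\<^sup>2"
        using C[of t] by (intro mult_left_mono) auto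
      also have "\<dots> = m" using t \<rho> by (simp add: C_def)
      finally have "v x t < m" using \<delta> by (simp add: v_def G_def)
      moreover have "m < u x t" using d1(2)[of x] n \<rho> t by (simp add: y0 dist_norm)
      ultimately show False using le by simp
    qed
    then have t: "t0 < t" using xt by (simp add: Q)
    \<comment> \<open>Going back by a time below \<open>e\<close> moves the centre by at most
      \<open>e * norm w\<close>, and the point itself moves by less than \<open>e\<close>; together
      this stays within the gap to the edge.\<close>
    define e where "e = min (t - t0) ((\<rho> - norm (x - y t)) / (1 + norm w))"
    have nw: "0 < 1 + norm w" by (simp add: add_pos_nonneg)
    have e0: "0 < e" using t n nw by (simp add: e_def)
    have e1: "e * (1 + norm w) \<le> \<rho> - norm (x - y t)"
      using nw by (simp add: e_def pos_le_divide_eq[symmetric])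
    have "(z, s) \<in> Q" if z: "dist z x < e" "t - e < s" "s \<le> t" for z s
    proof -
      have zs: "z - y s = (z - x) + (x - y t) + (t - s) *\<^sub>R w" by (simp add: y_def algebra_simps)
      have "norm (z - y s) \<le> norm (z - x) + norm (x - y t) + norm ((t - s) *\<^sub>R w)"
        unfolding zs by (intro norm_triangle_mono order_refl)
      moreover have "norm ((t - s) *\<^sub>R w) \<le> e * norm w"
        using z by (simp add: mult_right_mono)
      ultimately have "norm (z - y s) \<le> \<rho>" using e1 z by (simp add: dist_norm algebra_simps)
      moreover have "t0 \<le> s" "s \<le> t1" using z xt by (auto simp: e_def Q)
      ultimately show ?thesis by (simp add: Q)
    qed
    then show "\<exists>e>0. \<forall>z s. dist z x < e \<and> t - e < s \<and> s \<le> t \<longrightarrow> (z, s) \<in> Q" using e0 by blast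
  next
    fix x t
    show "(G t has_real_derivative - 2 * C t * (\<rho>\<^sup>2 - (norm (x - y t))\<^sup>2)) (at ((norm (x - y t))\<^sup>2))"
      unfolding G_def by (auto intro!: derivative_eq_intros simp: algebra_simps)
    show "((\<lambda>r. - 2 * C t * (\<rho>\<^sup>2 - r)) has_real_derivative 2 * C t) (at ((norm (x - y t))\<^sup>2))"
      by (auto intro!: derivative_eq_intros)
    have n: "(norm (x - y s))\<^sup>2 = (norm (x - x0))\<^sup>2 - 2 * (s - t0) * ((x - x0) \<bullet> w) + (s - t0)\<^sup>2 * (w \<bullet> w)" for s
      unfolding y_def power2_norm_eq_inner
      by (simp add: inner_diff_left inner_diff_right inner_add_left inner_add_right inner_commute
          algebra_simps power2_eq_square)
    have i: "(x - y t) \<bullet> w = (x - x0) \<bullet> w - (t - t0) * (w \<bullet> w)"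
      by (simp add: y_def inner_diff_left inner_add_left)
    show "(v x has_real_derivative vt x t) (at t)"
      unfolding v_def vt_def G_def n i C_def
      by (rule derivative_eq_intros refl)+ (simp add: algebra_simps power2_eq_square)
  next
    fix x t assume xt: "(x, t) \<in> Q" and eq: "v x t = u x t"
    define r where "r = (norm (x - y t))\<^sup>2"
    define s where "s = \<rho>\<^sup>2 - r"
    have s: "0 \<le> s" using xt by (simp add: s_def r_def Q power_mono)
    have v0: "0 \<le> v x t" using global_solutionD(2)[OF sol, of t x] eq xt t01 by (simp add: Q)
    have vs: "v x t \<le> C t * s\<^sup>2" using \<delta> by (simp add: v_def G_def s_def r_def)
    have "V x * v x t \<le> M * v x t" using M(2)[OF QK[OF xt]] v0 by (rule mult_right_mono)
    also have "\<dots> \<le> M * (C t * s\<^sup>2)" using vs M(1) by simp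
    finally have Vv: "V x * v x t \<le> M * (C t * s\<^sup>2)" .
    have "(x - y t) \<bullet> w \<le> norm (x - y t) * norm w" by (rule norm_cauchy_schwarz)
    also have "\<dots> \<le> \<rho> * norm w" using xt by (simp add: Q mult_right_mono)
    finally have "4 * s * ((x - y t) \<bullet> w) \<le> 4 * s * (\<rho> * norm w)"
      using s by (intro mult_left_mono) auto
    \<comment> \<open>In this variable the square completes: \<open>X^2 - 4 * \<rho> * X + 8 *
      \<rho>^2 = (X - 2 * \<rho>)^2 + 4 * \<rho>^2\<close>.\<close>
    define X where "X = D / (4 * \<rho>) * s"
    have DX: "D * s = 4 * \<rho> * X" using \<rho> by (simp add: X_def)
    have kX: "k * s\<^sup>2 = M * s\<^sup>2 + X\<^sup>2" by (simp add: k_def X_def distrib_right flip: power_mult_distrib)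
    have "0 < (X - 2 * \<rho>)\<^sup>2 + 4 * \<rho>\<^sup>2" using \<rho> by (simp add: add_nonneg_pos)
    then have "- (X\<^sup>2) + 4 * \<rho> * X < 8 * \<rho>\<^sup>2" by (simp add: power2_eq_square algebra_simps)
    then have "- k * s\<^sup>2 + D * s < 8 * \<rho>\<^sup>2 - M * s\<^sup>2" unfolding DX using kX by simp
    moreover have "D * s = 4 * s * (\<rho> * norm w) + 8 * s + 4 * N * s" by (simp add: D_def algebra_simps)
    ultimately have "- k * s\<^sup>2 + 4 * s * ((x - y t) \<bullet> w) < 8 * r - 4 * N * s - M * s\<^sup>2"
      using \<open>4 * s * ((x - y t) \<bullet> w) \<le> _\<close> by (simp add: s_def)
    then have "C t * (- k * s\<^sup>2 + 4 * s * ((x - y t) \<bullet> w)) < C t * (8 * r - 4 * N * s - M * s\<^sup>2)"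
      using C[of t] by (rule mult_strict_left_mono)
    also have "\<dots> = 8 * r * C t - 4 * N * s * C t - M * (C t * s\<^sup>2)" by (simp add: algebra_simps)
    finally have "vt x t < 8 * r * C t - 4 * N * s * C t - V x * v x t"
      using Vv unfolding vt_def r_def[symmetric] s_def[symmetric] by linarith
    moreover have "0 \<le> a x * v x t powr p" using a[of x] by simp
    ultimately show "vt x t < 4 * (norm (x - y t))\<^sup>2 * (2 * C t)
        + 2 * real CARD('n) * (- 2 * C t * (\<rho>\<^sup>2 - (norm (x - y t))\<^sup>2)) - V x * v x t + a x * v x t powr p"
      by (simp add: r_def[symmetric] s_def[symmetric] N_def[symmetric] algebra_simps)
  qed
  moreover have "v x1 t1 = 0" by (simp add: v_def G_def y1 \<delta>_def)
  ultimately show ?thesis by simp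
qed

text \<open>A segment through the origin is replaced by a detour. Its endpoints lie on opposite
  rays, so a nonzero \<open>z\<close> orthogonal to one is orthogonal to both; such a
  \<open>z\<close> exists in dimension at least 2. A segment between nonzero orthogonal vectors
  misses 0, and each of the two legs takes half of the time.\<close>

lemma positivity:
  fixes u :: "real ^ 'n::finite \<Rightarrow> real \<Rightarrow> real"
  assumes n: "2 \<le> CARD('n)" and sol: "global_solution V a p \<phi> u"
    and V: "\<And>K. compact K \<Longrightarrow> K \<subseteq> - {0} \<Longrightarrow> continuous_on K V"
    and a: "\<And>x. 0 < a x"
    and t01: "0 \<le> t0" "t0 < t1" and pos: "0 < u x0 t0" and x01: "x0 \<noteq> 0" "x1 \<noteq> 0"
  shows "0 < u x1 t1"
proof (cases "0 \<in> closed_segment x0 x1")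
  case False
  show ?thesis by (rule positivity_along_segment[OF sol _ _ t01 pos False]) (use V a in auto)
next
  case True
  then obtain l where l: "0 \<le> l" "l \<le> 1" "(1 - l) *\<^sub>R x0 + l *\<^sub>R x1 = 0"
    by (auto simp: closed_segment_def)
  obtain z where z: "z \<noteq> 0" "orthogonal x0 z"
    using orthogonal_to_vector_exists[of x0] n by auto
  have "(1 - l) * (x0 \<bullet> z) + l * (x1 \<bullet> z) = 0"
    using arg_cong[OF l(3), of "\<lambda>w. w \<bullet> z"] by (simp add: inner_add_left)
  moreover have "l \<noteq> 0" using l(3) x01 by auto
  ultimately have z1: "orthogonal z x1" using z(2) by (simp add: orthogonal_def inner_commute)
  have no: "0 \<notin> closed_segment x z" if "x \<noteq> 0" "orthogonal x z" for x
  proof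
    assume "0 \<in> closed_segment x z"
    then obtain l where l: "(1 - l) *\<^sub>R x + l *\<^sub>R z = 0" by (auto simp: closed_segment_def)
    have "l * (z \<bullet> z) = ((1 - l) *\<^sub>R x + l *\<^sub>R z) \<bullet> z"
      "(1 - l) * (x \<bullet> x) = ((1 - l) *\<^sub>R x + l *\<^sub>R z) \<bullet> x"
      using that(2) by (simp_all add: inner_add_left inner_add_right orthogonal_def inner_commute)
    then show False using that z(1) unfolding l by auto
  qed
  define s where "s = (t0 + t1) / 2"
  have s: "t0 < s" "s < t1" using t01 by (auto simp: s_def)
  have "0 < u z s"
    by (rule positivity_along_segment[OF sol _ _ t01(1) s(1) pos no[OF x01(1) z(2)]]) (use V a in auto)
  moreover have "0 \<notin> closed_segment z x1"
    using no[OF x01(2)] z1 by (simp add: orthogonal_commute closed_segment_commute)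
  moreover have "0 \<le> s" using s t01 by simp
  ultimately show ?thesis
    by (intro positivity_along_segment[OF sol _ _ _ s(2)]) (use V a in auto)
qed

section \<open>Fixed cylinders and exponential growth on an annulus\<close>

text \<open>Supplies hypothesis \<open>nb\<close> of \<open>comparison\<close> when the spatial
  domain does not move.\<close>

lemma parabolic_neighbourhood_in_cylinder:
  fixes K :: "'a::metric_space set"
  assumes "x \<in> interior K" "t0 < t" "t \<le> T"
  shows "\<exists>e>0. \<forall>z s. dist z x < e \<and> t - e < s \<and> s \<le> t \<longrightarrow> (z, s) \<in> K \<times> {t0..T}"
proof -
  obtain d where d: "0 < d" "ball x d \<subseteq> K" using assms(1) mem_interior by blast
  show ?thesis
    by (rule exI[of _ "min d (t - t0)"]) (use d assms in \<open>auto simp: subset_iff dist_commute\<close>)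
qed

text \<open>The spatial profile satisfies \<open>\<Delta>\<psi> = - 4 * (\<mu>^2 + \<kappa>^2) /
  |x|^2 * \<psi>\<close>, where \<open>4 * \<mu>^2\<close> is the Hardy constant. Where
  \<open>\<psi> > 0\<close>, the bound on \<open>V\<close> leaves a surplus
  \<open>k / |x|^2 * \<psi>\<close> with \<open>k > 0\<close>, which drives the factor
  \<open>exp (\<delta> * (t - 1))\<close>; the reaction term only helps.\<close>

lemma exponential_growth_on_annulus:
  fixes u :: "real ^ 'n::finite \<Rightarrow> real \<Rightarrow> real"
  assumes n: "2 \<le> CARD('n)" and sol: "global_solution V a p \<phi> u"
    and pos: "\<And>x t. x \<noteq> 0 \<Longrightarrow> 0 < t \<Longrightarrow> 0 < u x t"
    and a: "\<And>x. 0 < a x"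
    and V: "\<And>x. 2 \<le> norm x \<Longrightarrow> V x \<le> \<omega> / (norm x)\<^sup>2"
    and \<mu>: "\<mu> = (real CARD('n) - 2) / 4"
    and \<kappa>: "0 < \<kappa>" "\<omega> + 4 * (\<mu>\<^sup>2 + \<kappa>\<^sup>2) < 0"
    and R: "R = 2 * exp (pi / (2 * \<kappa>))"
  obtains c \<delta> where "0 < c" "0 < \<delta>"
    "\<And>x t. 2 \<le> norm x \<Longrightarrow> norm x \<le> R \<Longrightarrow> 1 \<le> t \<Longrightarrow>
      c * exp (\<delta> * (t - 1)) * ((norm x)\<^sup>2 powr - \<mu> * sin (\<kappa> * ln ((norm x)\<^sup>2 / 4))) < u x t"
proof -
  define A :: "(real ^ 'n) set" where "A = cball 0 R - ball 0 2"
  have A: "x \<in> A \<longleftrightarrow> 2 \<le> norm x \<and> norm x \<le> R" for x by (auto simp: A_def)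
  have cA: "compact A" unfolding A_def by (intro compact_diff compact_cball open_ball)
  have R2: "2 < R" using \<kappa> by (simp add: R)
  have "A \<noteq> {}"
  proof -
    obtain x :: "real ^ 'n" where "norm x = 2" using vector_choose_size[of 2] by auto
    then show ?thesis using A[of x] R2 by auto
  qed
  have \<mu>0: "0 \<le> \<mu>" using n by (simp add: \<mu>)
  have "continuous_on A (\<lambda>x. u x 1)"
    by (rule continuous_on_subset[OF global_solution_continuous_on_slice[OF sol]]) (auto simp: A_def)
  then obtain x0 where x0: "x0 \<in> A" "\<And>x. x \<in> A \<Longrightarrow> u x0 1 \<le> u x 1"
    using continuous_attains_inf[OF cA \<open>A \<noteq> {}\<close>] by blast
  \<comment> \<open>Half the minimum of \<open>u\<close> on the annulus at time 1. The profile is at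
    most 1 there because \<open>norm x \<ge> 1\<close> and \<open>\<mu> \<ge> 0\<close>, so
    \<open>v\<close> starts strictly below \<open>u\<close>.\<close>
  define c where "c = u x0 1 / 2"
  have posA: "0 < u x t" if "x \<in> A" "1 \<le> t" for x t
    using that by (intro pos) (auto simp: A)
  have c: "0 < c" "c < u x0 1" using posA[OF x0(1)] by (auto simp: c_def)
  define k where "k = - (\<omega> + 4 * (\<mu>\<^sup>2 + \<kappa>\<^sup>2))"
  have k: "0 < k" using \<kappa> by (simp add: k_def)
  \<comment> \<open>Half of the least surplus \<open>k / R^2\<close>, which makes the differential
    inequality strict.\<close>
  define \<delta> where "\<delta> = k / (2 * R\<^sup>2)"
  have \<delta>: "0 < \<delta>" using k R2 by (simp add: \<delta>_def)
  define E where "E = (\<lambda>t. c * exp (\<delta> * (t - 1)))"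
  have E: "0 < E t" for t using c by (simp add: E_def)
  define L where "L = (\<lambda>r. \<kappa> * ln (r / 4))"
  define G where "G = (\<lambda>t r. E t * (r powr - \<mu> * sin (L r)))"
  define v where "v = (\<lambda>(x :: real ^ 'n) t. G t ((norm (x - 0))\<^sup>2))"
  have main: "v x1 t1 < u x1 t1" if x1: "x1 \<in> A" and t1: "1 \<le> t1" for x1 t1
  proof (rule comparison[OF sol, where Q = "A \<times> {1..t1}" and G = G and y = "\<lambda>_. 0"
        and vt = "\<lambda>x t. \<delta> * v x t"
        and G' = "\<lambda>t r. E t * (r powr (- \<mu> - 1) * (\<kappa> * cos (L r) - \<mu> * sin (L r)))"
        and G'' = "\<lambda>t r. E t * (r powr (- \<mu> - 2) *
          ((\<mu> * (\<mu> + 1) - \<kappa>\<^sup>2) * sin (L r) - \<kappa> * (2 * \<mu> + 1) * cos (L r)))"])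
    show "compact (A \<times> {1..t1})" by (intro compact_Times cA compact_Icc)
    show "A \<times> {1..t1} \<subseteq> (- {0}) \<times> {0..}" by (auto simp: A)
    show "continuous_on (A \<times> {1..t1}) (\<lambda>(x, t). v x t)"
      unfolding v_def G_def E_def L_def case_prod_beta
      by (intro continuous_intros) (auto simp: A)
    show "v x t = G t ((norm (x - 0))\<^sup>2)" for x t by (simp add: v_def)
    show "(x1, t1) \<in> A \<times> {1..t1}" using that by simp
  next
    fix x t assume xt: "(x, t) \<in> A \<times> {1..t1}" and le: "u x t \<le> v x t"
    have "0 < v x t" using posA[of x t] le xt by simp
    \<comment> \<open>The phase \<open>L\<close> is 0 at radius 2 and \<open>pi\<close> at radius
      \<open>R\<close>; the sine vanishes at both, whereas \<open>v\<close> is positive at a contact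
      candidate.\<close>
    have "norm x \<noteq> 2"
      using \<open>0 < v x t\<close> by (auto simp: v_def G_def L_def)
    moreover have "norm x \<noteq> R"
    proof
      assume "norm x = R"
      then have "(norm x)\<^sup>2 / 4 = exp (2 * (pi / (2 * \<kappa>)))"
        unfolding \<open>norm x = R\<close> R exp_double by (simp add: power_mult_distrib)
      then have "L ((norm x)\<^sup>2) = pi" using \<kappa>(1) by (simp add: L_def)
      then show False using \<open>0 < v x t\<close> by (simp add: v_def G_def)
    qed
    ultimately have "x \<in> ball 0 R - cball 0 2" using xt by (auto simp: A)
    moreover have "ball 0 R - cball 0 2 \<subseteq> interior A"
      by (rule interior_maximal) (auto simp: A_def intro!: open_Diff)
    ultimately have xi: "x \<in> interior A" by blast
    have "t \<noteq> 1"
    proof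
      assume t: "t = 1"
      have "((norm x)\<^sup>2) powr - \<mu> \<le> 1"
      proof -
        have "1 \<le> (norm x)\<^sup>2" using xt by (simp add: A one_le_power)
        then have "((norm x)\<^sup>2) powr - \<mu> \<le> ((norm x)\<^sup>2) powr 0" using \<mu>0 by (intro powr_mono) auto
        then show ?thesis using \<open>1 \<le> (norm x)\<^sup>2\<close> by (auto split: if_splits)
      qed
      then have "((norm x)\<^sup>2) powr - \<mu> * sin (L ((norm x)\<^sup>2)) \<le> 1"
        using order_trans[OF mult_left_mono[OF sin_le_one]] by simp
      then have "v x t \<le> c" using c(1) t by (simp add: v_def G_def E_def)
      then show False using le c(2) x0(2)[of x] xt t by simp
    qed
    then show "\<exists>e>0. \<forall>z s. dist z x < e \<and> t - e < s \<and> s \<le> t \<longrightarrow> (z, s) \<in> A \<times> {1..t1}"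
      using xt xi by (intro parabolic_neighbourhood_in_cylinder) auto
  next
    fix x t assume xt: "(x, t) \<in> A \<times> {1..t1}"
    define r where "r = (norm (x - 0))\<^sup>2"
    have r: "0 < r" using xt by (auto simp: r_def A)
    have L: "(L has_real_derivative \<kappa> / r) (at r)"
      unfolding L_def using r by (auto intro!: derivative_eq_intros)
    have P: "((\<lambda>r. r powr q) has_real_derivative q * r powr (q - 1)) (at r)" for q
      using has_real_derivative_powr[OF r] .
    have p1: "r powr (q - 1) = r powr q / r" for q using r by (simp add: powr_diff)
    have p2: "r powr (- \<mu> - 2) = r powr (- \<mu> - 1) / r" using r by (simp add: powr_diff power2_eq_square)
    have "(G t has_real_derivative E t * (r powr (- \<mu> - 1) * (\<kappa> * cos (L r) - \<mu> * sin (L r)))) (at r)"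
      unfolding G_def
      by (rule derivative_eq_intros P L refl)+ (use r in \<open>simp add: p1 field_simps\<close>)
    then show "(G t has_real_derivative E t * ((norm (x - 0))\<^sup>2 powr (- \<mu> - 1) *
        (\<kappa> * cos (L ((norm (x - 0))\<^sup>2)) - \<mu> * sin (L ((norm (x - 0))\<^sup>2))))) (at ((norm (x - 0))\<^sup>2))"
      by (simp only: r_def)
    have "((\<lambda>r. E t * (r powr (- \<mu> - 1) * (\<kappa> * cos (L r) - \<mu> * sin (L r)))) has_real_derivative
        E t * (r powr (- \<mu> - 2) *
          ((\<mu> * (\<mu> + 1) - \<kappa>\<^sup>2) * sin (L r) - \<kappa> * (2 * \<mu> + 1) * cos (L r)))) (at r)"
      by (rule derivative_eq_intros P L refl)+
        (use r in \<open>simp add: p1[of "- \<mu> - 1"] p2 field_simps power2_eq_square\<close>)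
    then show "((\<lambda>r. E t * (r powr (- \<mu> - 1) * (\<kappa> * cos (L r) - \<mu> * sin (L r)))) has_real_derivative
        E t * ((norm (x - 0))\<^sup>2 powr (- \<mu> - 2) * ((\<mu> * (\<mu> + 1) - \<kappa>\<^sup>2) * sin (L ((norm (x - 0))\<^sup>2))
          - \<kappa> * (2 * \<mu> + 1) * cos (L ((norm (x - 0))\<^sup>2))))) (at ((norm (x - 0))\<^sup>2))"
      by (simp only: r_def)
    show "(v x has_real_derivative \<delta> * v x t) (at t)"
      unfolding v_def G_def E_def by (auto intro!: derivative_eq_intros)
  next
    fix x t assume xt: "(x, t) \<in> A \<times> {1..t1}" and eq: "v x t = u x t"
    have x2: "2 \<le> norm x" "norm x \<le> R" using xt by (auto simp: A)
    define r where "r = (norm (x - 0))\<^sup>2"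
    have r: "0 < r" "r \<le> R\<^sup>2" using x2 by (auto simp: r_def power_mono)
    define P S D where "P = r powr (- \<mu>)" and "S = sin (L r)" and "D = cos (L r)"
    have v0: "0 < v x t" using posA[of x t] eq xt by simp
    have vP: "v x t = E t * (P * S)" by (simp add: v_def G_def P_def S_def r_def)
    have N: "real CARD('n) = 4 * \<mu> + 2" by (simp add: \<mu> field_simps)
    have p1: "r powr (- \<mu> - 1) = P / r" and p2: "r powr (- \<mu> - 2) = P / r\<^sup>2"
      using r by (simp_all add: powr_diff P_def)
    \<comment> \<open>The cosine coefficients \<open>- 4 * \<kappa> * (2 * \<mu> + 1)\<close> and
      \<open>2 * (4 * \<mu> + 2) * \<kappa>\<close> cancel, which is what fixes
      \<open>\<mu>\<close>; the sine coefficients add up to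
      \<open>- 4 * (\<mu>^2 + \<kappa>^2)\<close>.\<close>
    have lap: "4 * r * (E t * (P / r\<^sup>2 * ((\<mu> * (\<mu> + 1) - \<kappa>\<^sup>2) * S - \<kappa> * (2 * \<mu> + 1) * D)))
        + 2 * (4 * \<mu> + 2) * (E t * (P / r * (\<kappa> * D - \<mu> * S)))
        = - (4 * (\<mu>\<^sup>2 + \<kappa>\<^sup>2)) / r * (E t * (P * S))"
      using r by (simp add: field_simps power2_eq_square)
    have "V x * v x t \<le> \<omega> / r * v x t"
      using V[OF x2(1)] v0 by (intro mult_right_mono) (auto simp: r_def)
    moreover have "\<delta> < k / r"
    proof -
      have "k / (2 * R\<^sup>2) < k / r" using r k R2 by (intro divide_strict_left_mono) auto
      then show ?thesis by (simp add: \<delta>_def)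
    qed
    then have "\<delta> * v x t < k / r * v x t" using v0 by (rule mult_strict_right_mono)
    moreover have "k / r * v x t = - (4 * (\<mu>\<^sup>2 + \<kappa>\<^sup>2)) / r * v x t - \<omega> / r * v x t"
      using r by (simp add: k_def field_simps)
    moreover have "0 \<le> a x * v x t powr p" using a[of x] by simp
    ultimately have "\<delta> * v x t < - (4 * (\<mu>\<^sup>2 + \<kappa>\<^sup>2)) / r * v x t - V x * v x t + a x * v x t powr p"
      by simp
    then show "\<delta> * v x t < 4 * (norm (x - 0))\<^sup>2 * (E t * ((norm (x - 0))\<^sup>2 powr (- \<mu> - 2) *
          ((\<mu> * (\<mu> + 1) - \<kappa>\<^sup>2) * sin (L ((norm (x - 0))\<^sup>2))
            - \<kappa> * (2 * \<mu> + 1) * cos (L ((norm (x - 0))\<^sup>2)))))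
        + 2 * real CARD('n) * (E t * ((norm (x - 0))\<^sup>2 powr (- \<mu> - 1) *
          (\<kappa> * cos (L ((norm (x - 0))\<^sup>2)) - \<mu> * sin (L ((norm (x - 0))\<^sup>2)))))
        - V x * v x t + a x * v x t powr p"
      unfolding r_def[symmetric] S_def[symmetric] D_def[symmetric] p1 p2 N lap vP[symmetric] .
  qed
  show ?thesis
    by (rule that[OF c(1) \<delta>]) (use main in \<open>simp add: A v_def G_def E_def L_def\<close>)
qed

section \<open>Blow-up in finite time\<close>

text \<open>With \<open>q = 1 / (p - 1)\<close>, the function \<open>v = Z powr - q\<close> has
  \<open>v powr p = Z powr (- q - 1)\<close>, the same power as in its time derivative and in the
  first-order part of its Laplacian. The inequality thus reduces to comparing constants, while the
  second-order part and the potential term have a favourable sign.\<close>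

lemma blowup:
  fixes u :: "real ^ 'n::finite \<Rightarrow> real \<Rightarrow> real"
  assumes sol: "global_solution V a p \<phi> u" and p: "1 < p"
    and \<rho>: "0 < \<rho>" "0 \<notin> cball y \<rho>"
    and V: "\<And>x. x \<in> cball y \<rho> \<Longrightarrow> V x \<le> 0"
    and a: "continuous_on (cball y \<rho>) a" "\<And>x. x \<in> cball y \<rho> \<Longrightarrow> 0 < a x"
    and large: "\<And>B. \<exists>t0\<ge>0. \<forall>t\<ge>t0. \<forall>x\<in>cball y \<rho>. B < u x t"
  shows False
proof -
  obtain z where z: "z \<in> cball y \<rho>" "\<And>x. x \<in> cball y \<rho> \<Longrightarrow> a z \<le> a x"
    using continuous_attains_inf[OF compact_cball _ a(1)] \<rho>(1) by fastforce
  define a0 where "a0 = a z"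
  have a0: "0 < a0" "\<And>x. x \<in> cball y \<rho> \<Longrightarrow> a0 \<le> a x" using z a(2) by (auto simp: a0_def)
  define q where "q = 1 / (p - 1)"
  have q: "0 < q" "q * p = q + 1" using p by (simp_all add: q_def field_simps)
  define N where "N = real CARD('n)"
  have N: "0 < N" by (simp add: N_def)
  \<comment> \<open>With these values of \<open>\<gamma>\<close> and \<open>\<beta>\<close>, the
    time derivative and the negative part of the Laplacian each use a quarter of the reaction term
    \<open>a0 * P\<close>.\<close>
  define \<gamma> where "\<gamma> = a0 / (8 * N * q)"
  define \<beta> where "\<beta> = a0 / (4 * q)"
  \<comment> \<open>On the lateral boundary \<open>Z = 2 * \<alpha> - \<beta> * (t - t0)\<close>,
    which exceeds \<open>\<alpha>\<close> as long as \<open>\<beta> * (t - t0) < \<alpha>\<close>.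
    On the initial slice also \<open>Z \<ge> \<alpha>\<close>, so in both places
    \<open>v \<le> \<alpha> powr - q < u\<close>.\<close>
  define \<alpha> where "\<alpha> = \<gamma> * \<rho>\<^sup>2"
  have \<gamma>: "0 < \<gamma>" and \<beta>: "0 < \<beta>" and \<alpha>: "0 < \<alpha>"
    using a0 q N \<rho> by (simp_all add: \<gamma>_def \<beta>_def \<alpha>_def)
  obtain t0 where t0: "0 \<le> t0" "\<And>t x. t0 \<le> t \<Longrightarrow> x \<in> cball y \<rho> \<Longrightarrow> \<alpha> powr - q < u x t"
    using large by metis
  define Z where "Z = (\<lambda>t r. \<alpha> - \<beta> * (t - t0) + \<gamma> * r)"
  define G where "G = (\<lambda>t r. Z t r powr - q)"
  define v where "v = (\<lambda>x t. G t ((norm (x - y))\<^sup>2))"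
  have below: "v y T < u y T" if T: "t0 \<le> T" "\<beta> * (T - t0) < \<alpha>" for T
  proof -
    have Zpos: "0 < Z t ((norm (x - y))\<^sup>2)" if "(x, t) \<in> cball y \<rho> \<times> {t0..T}" for x t
    proof -
      have "\<beta> * (t - t0) \<le> \<beta> * (T - t0)" using that \<beta> by simp
      moreover have "0 \<le> \<gamma> * (norm (x - y))\<^sup>2" using \<gamma> by simp
      ultimately show ?thesis using T by (simp add: Z_def)
    qed
    show ?thesis
    proof (rule comparison[OF sol, where Q = "cball y \<rho> \<times> {t0..T}" and G = G and y = "\<lambda>_. y"
          and vt = "\<lambda>x t. q * \<beta> * Z t ((norm (x - y))\<^sup>2) powr (- q - 1)"
          and G' = "\<lambda>t r. - q * \<gamma> * Z t r powr (- q - 1)"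
          and G'' = "\<lambda>t r. q * (q + 1) * \<gamma>\<^sup>2 * Z t r powr (- q - 2)"])
      show "compact (cball y \<rho> \<times> {t0..T})" by (intro compact_Times compact_cball compact_Icc)
      show "cball y \<rho> \<times> {t0..T} \<subseteq> (- {0}) \<times> {0..}" using \<rho>(2) t0(1) by auto
      show "continuous_on (cball y \<rho> \<times> {t0..T}) (\<lambda>(x, t). v x t)"
        unfolding v_def G_def case_prod_beta
      proof (intro continuous_on_powr continuous_on_const ballI)
        show "continuous_on (cball y \<rho> \<times> {t0..T}) (\<lambda>z. Z (snd z) ((norm (fst z - y))\<^sup>2))"
          unfolding Z_def by (intro continuous_intros)
        show "Z (snd z) ((norm (fst z - y))\<^sup>2) \<noteq> 0" if "z \<in> cball y \<rho> \<times> {t0..T}" for z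
          using Zpos[of "fst z" "snd z"] that by simp
      qed
      show "v x t = G t ((norm (x - y))\<^sup>2)" for x t by (simp add: v_def)
      show "(y, T) \<in> cball y \<rho> \<times> {t0..T}" using T \<rho> by simp
    next
      fix x t assume xt: "(x, t) \<in> cball y \<rho> \<times> {t0..T}" and le: "u x t \<le> v x t"
      have lt: "\<alpha> powr - q < v x t" using t0(2)[of t x] le xt by auto
      have Zlt: "Z t ((norm (x - y))\<^sup>2) < \<alpha>"
      proof (rule ccontr)
        assume "\<not> ?thesis"
        then have "v x t \<le> \<alpha> powr - q" unfolding v_def G_def using \<alpha> q by (intro powr_mono2') auto
        then show False using lt by simp
      qed
      have "t \<noteq> t0" using Zlt \<gamma> by (auto simp: Z_def mult_less_0_iff)
      moreover have "dist y x \<noteq> \<rho>"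
      proof
        assume "dist y x = \<rho>"
        then have "norm (x - y) = \<rho>" by (simp add: dist_norm norm_minus_commute)
        moreover have "\<beta> * (t - t0) \<le> \<beta> * (T - t0)" using xt \<beta> by simp
        ultimately show False using Zlt T by (simp add: Z_def \<alpha>_def)
      qed
      then have "x \<in> interior (cball y \<rho>)" using xt by simp
      ultimately show "\<exists>e>0. \<forall>z s. dist z x < e \<and> t - e < s \<and> s \<le> t \<longrightarrow> (z, s) \<in> cball y \<rho> \<times> {t0..T}"
        using xt by (intro parabolic_neighbourhood_in_cylinder) auto
    next
      fix x t assume xt: "(x, t) \<in> cball y \<rho> \<times> {t0..T}"
      note Zp = Zpos[OF xt]
      have Zr: "(Z t has_real_derivative \<gamma>) (at r)" for r
        unfolding Z_def by (auto intro!: derivative_eq_intros)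
      have Zt: "((\<lambda>t. Z t r) has_real_derivative - \<beta>) (at t)" for r
        unfolding Z_def by (auto intro!: derivative_eq_intros)
      let ?r = "(norm (x - y))\<^sup>2"
      have Dr: "((\<lambda>r. Z t r powr s) has_real_derivative s * Z t ?r powr (s - 1) * \<gamma>) (at ?r)" for s
        by (rule DERIV_chain2[where f = "\<lambda>z. z powr s" and g = "Z t", OF has_real_derivative_powr[OF Zp] Zr])
      have Dt: "((\<lambda>t. Z t ?r powr s) has_real_derivative s * Z t ?r powr (s - 1) * - \<beta>) (at t)" for s
        by (rule DERIV_chain2[where f = "\<lambda>z. z powr s" and g = "\<lambda>t. Z t ?r",
              OF has_real_derivative_powr[OF Zp] Zt])
      show "(G t has_real_derivative - q * \<gamma> * Z t ((norm (x - y))\<^sup>2) powr (- q - 1)) (at ((norm (x - y))\<^sup>2))"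
        unfolding G_def by (rule DERIV_cong[OF Dr]) simp
      show "((\<lambda>r. - q * \<gamma> * Z t r powr (- q - 1)) has_real_derivative
          q * (q + 1) * \<gamma>\<^sup>2 * Z t ((norm (x - y))\<^sup>2) powr (- q - 2)) (at ((norm (x - y))\<^sup>2))"
        by (rule DERIV_cong[OF DERIV_cmult[OF Dr]])
          (simp add: power2_eq_square algebra_simps)
      show "(v x has_real_derivative q * \<beta> * Z t ((norm (x - y))\<^sup>2) powr (- q - 1)) (at t)"
        unfolding v_def G_def by (rule DERIV_cong[OF Dt]) simp
      define P where "P = Z t ((norm (x - y))\<^sup>2) powr (- q - 1)"
      have P: "0 < P" using Zp by (simp add: P_def)
      have "- q * p = - q - 1" using q(2) by simp
      then have vp: "v x t powr p = P"
        unfolding v_def G_def P_def powr_powr by simp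
      have "a0 * P \<le> a x * P" using a0(2)[of x] xt P by simp
      moreover have "V x * v x t \<le> 0"
        using V[of x] xt by (intro mult_nonpos_nonneg) (auto simp: v_def G_def)
      moreover have "0 \<le> 4 * (norm (x - y))\<^sup>2 * (q * (q + 1) * \<gamma>\<^sup>2 * Z t ((norm (x - y))\<^sup>2) powr (- q - 2))"
        using q by simp
      moreover have "q * \<beta> * P = a0 * P / 4" "2 * N * (- q * \<gamma> * P) = - (a0 * P / 4)"
        using q N by (simp_all add: \<beta>_def \<gamma>_def)
      moreover have "0 < a0 * P" using a0 P by simp
      ultimately show "q * \<beta> * Z t ((norm (x - y))\<^sup>2) powr (- q - 1)
        < 4 * (norm (x - y))\<^sup>2 * (q * (q + 1) * \<gamma>\<^sup>2 * Z t ((norm (x - y))\<^sup>2) powr (- q - 2))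
          + 2 * real CARD('n) * (- q * \<gamma> * Z t ((norm (x - y))\<^sup>2) powr (- q - 1))
          - V x * v x t + a x * v x t powr p"
        unfolding P_def[symmetric] N_def[symmetric] vp by linarith
    qed
  qed
  have "y \<noteq> 0" using \<rho> by auto
  \<comment> \<open>Globality enters here: \<open>u y\<close> is continuous, hence bounded, up to
    and including the time at which \<open>Z\<close> reaches 0 at \<open>y\<close>.\<close>
  then have "continuous_on {t0..t0 + \<alpha> / \<beta>} (\<lambda>t. (\<lambda>(x, t). u x t) (y, t))"
    by (intro continuous_on_compose2[OF global_solutionD(1)[OF sol]] continuous_intros) (use t0 in auto)
  then have "bounded ((\<lambda>t. u y t) ` {t0..t0 + \<alpha> / \<beta>})"
    using compact_imp_bounded[OF compact_continuous_image] by fastforce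
  then obtain B where B: "0 < B" "\<And>t. t0 \<le> t \<Longrightarrow> t \<le> t0 + \<alpha> / \<beta> \<Longrightarrow> u y t \<le> B"
    by (auto simp: bounded_pos abs_le_iff)
  \<comment> \<open>The value of \<open>Z\<close> at \<open>y\<close> at the final time
    \<open>T\<close>: positive, so that comparison still applies, yet small enough for
    \<open>v y T\<close> to reach the bound \<open>B\<close>.\<close>
  define \<zeta> where "\<zeta> = min \<alpha> (B powr (- (1 / q)))"
  have \<zeta>: "0 < \<zeta>" "\<zeta> \<le> \<alpha>" using \<alpha> B by (auto simp: \<zeta>_def)
  define T where "T = t0 + (\<alpha> - \<zeta>) / \<beta>"
  have T: "t0 \<le> T" "\<beta> * (T - t0) = \<alpha> - \<zeta>" "T \<le> t0 + \<alpha> / \<beta>"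
    using \<zeta> \<beta> by (auto simp: T_def divide_right_mono)
  have "B = (B powr (- (1 / q))) powr - q" using B q by (simp add: powr_powr)
  also have "\<dots> \<le> \<zeta> powr - q" using \<zeta> q by (intro powr_mono2') (auto simp: \<zeta>_def)
  also have "\<dots> = v y T" using T(2) by (simp add: v_def G_def Z_def)
  also have "\<dots> < u y T" using below[OF T(1)] T(2) \<zeta> by simp
  finally show False using B(2)[OF T(1,3)] by simp
qed

section \<open>Nonexistence of global solutions\<close>

theorem corollary1:
  fixes a :: "real ^ 'n::finite \<Rightarrow> real" and \<beta> \<omega> :: real
  assumes "CARD('n) \<ge> 2"
    and "0 < \<beta>" and "\<beta> \<le> 1"
    and "locally_holder_on \<beta> UNIV a"
    and "\<forall>x. a x > 0"
    and "\<omega> < - (1 / 4) * (real CARD('n) - 2)\<^sup>2"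
  shows "\<exists>\<epsilon>>0. \<forall>V :: real ^ 'n \<Rightarrow> real.
    locally_holder_on \<beta> (- {0}) V \<longrightarrow>
    Liminf (at 0) (\<lambda>x. ereal (V x)) > -\<infinity> \<longrightarrow>
    (\<forall>x. norm x > \<epsilon> \<longrightarrow> V x \<le> \<omega> / (norm x)\<^sup>2) \<longrightarrow>
    (\<forall>p>1. \<forall>\<phi> :: real ^ 'n \<Rightarrow> real.
      continuous_on UNIV \<phi> \<longrightarrow> bounded (range \<phi>) \<longrightarrow>
      (\<forall>x. \<phi> x \<ge> 0) \<longrightarrow> (\<exists>x. \<phi> x \<noteq> 0) \<longrightarrow>
      \<not> (\<exists>u. global_solution V a p \<phi> u))"
proof (intro exI[of _ 1] conjI allI impI notI)
  \<comment> \<open>The radius 1 suffices because the annulus used below lies in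
    \<open>norm x \<ge> 2\<close>, and the assumed bound on \<open>V\<close> holds however large its
    outer radius is.\<close>
  fix V :: "real ^ 'n \<Rightarrow> real" and p :: real and \<phi> :: "real ^ 'n \<Rightarrow> real"
  assume V_holder: "locally_holder_on \<beta> (- {0}) V"
    and V: "\<forall>x. norm x > 1 \<longrightarrow> V x \<le> \<omega> / (norm x)\<^sup>2"
    and p: "1 < p" and \<phi>: "continuous_on UNIV \<phi>" "\<forall>x. \<phi> x \<ge> 0" "\<exists>x. \<phi> x \<noteq> 0"
    and "\<exists>u. global_solution V a p \<phi> u"
  then obtain u where sol: "global_solution V a p \<phi> u" by blast
  obtain z where "0 < \<phi> z" using \<phi>(2,3) by (metis less_eq_real_def)
  \<comment> \<open>The point \<open>z\<close> may be the origin; continuity of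
    \<open>\<phi>\<close> provides a nonzero starting point nearby.\<close>
  then have "\<forall>\<^sub>F x in at z. 0 < \<phi> x"
    using \<phi>(1) by (intro order_tendstoD(1)) (auto simp: continuous_on_eq_continuous_at isCont_def)
  moreover have "\<forall>\<^sub>F x in at z. x \<noteq> 0" by (rule eventually_neq_at_within)
  ultimately obtain x0 where x0: "0 < \<phi> x0" "x0 \<noteq> 0"
    using eventually_happens'[OF at_neq_bot eventually_conj] by blast
  have pos: "0 < u x t" if "x \<noteq> 0" "0 < t" for x t
    by (rule positivity[OF assms(1) sol _ _ order_refl that(2) _ x0(2) that(1)])
      (use assms x0 global_solutionD(3)[OF sol]
        locally_holder_on_imp_continuous_on[OF V_holder assms(2)] in auto)
  define \<mu> where "\<mu> = (real CARD('n) - 2) / 4"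
  \<comment> \<open>So \<open>4 * \<kappa>^2\<close> is half of the gap
    \<open>- \<omega> - 4 * \<mu>^2\<close>, leaving the other half as surplus.\<close>
  define \<kappa> where "\<kappa> = sqrt ((- \<omega> - 4 * \<mu>\<^sup>2) / 8)"
  have gap: "0 < - \<omega> - 4 * \<mu>\<^sup>2" using assms(6) by (simp add: \<mu>_def power_divide)
  then have "\<kappa>\<^sup>2 = (- \<omega> - 4 * \<mu>\<^sup>2) / 8" by (simp add: \<kappa>_def)
  then have \<kappa>: "0 < \<kappa>" "\<omega> + 4 * (\<mu>\<^sup>2 + \<kappa>\<^sup>2) < 0"
    using gap by (simp_all add: \<kappa>_def field_simps)
  have \<omega>: "\<omega> < 0" using gap by (smt (verit) zero_le_power2)
  define R where "R = 2 * exp (pi / (2 * \<kappa>))"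
  have R2: "2 < R" using \<kappa> by (simp add: R_def)
  define S where "S = (\<lambda>x :: real ^ 'n. (norm x)\<^sup>2 powr - \<mu> * sin (\<kappa> * ln ((norm x)\<^sup>2 / 4)))"
  obtain c \<delta> where c: "0 < c" and \<delta>: "0 < \<delta>" and growth: "\<And>x t. 2 \<le> norm x \<Longrightarrow> norm x \<le> R \<Longrightarrow> 1 \<le> t \<Longrightarrow>
      c * exp (\<delta> * (t - 1)) * S x < u x t"
    unfolding S_def
    by (rule exponential_growth_on_annulus[OF assms(1) sol pos _ _ \<mu>_def \<kappa> R_def])
      (use assms(5) V in auto)
  obtain y :: "real ^ 'n" where y: "norm y = (2 + R) / 2"
    using vector_choose_size[of "(2 + R) / 2"] R2 by auto
  \<comment> \<open>The centre \<open>y\<close> has the middle radius of the annulus and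
    \<open>\<rho>\<close> is half the distance to its boundary, so the profile has a positive
    minimum on the closed ball.\<close>
  define \<rho> where "\<rho> = (R - 2) / 4"
  have \<rho>: "0 < \<rho>" using R2 by (simp add: \<rho>_def)
  have ball: "2 < norm x \<and> norm x < R" if "x \<in> cball y \<rho>" for x
    using that norm_triangle_ineq2[of y x] norm_triangle_ineq2[of x y] y R2
    by (simp add: dist_norm norm_minus_commute \<rho>_def field_simps)
  have zero_notin: "0 \<notin> cball y \<rho>" using ball[of 0] by auto
  have Spos: "0 < S x" if "x \<in> cball y \<rho>" for x
  proof -
    have x: "2 < norm x" "norm x < R" using ball[OF that] by auto
    have "norm x / 2 < exp (pi / (2 * \<kappa>))" "0 < norm x / 2" using x by (auto simp: R_def)
    then have "ln (norm x / 2) < ln (exp (pi / (2 * \<kappa>)))" by (simp only: ln_less_cancel_iff exp_gt_zero)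
    then have "ln (norm x / 2) < pi / (2 * \<kappa>)" by simp
    moreover have "(norm x)\<^sup>2 / 4 = (norm x / 2)\<^sup>2" by (simp add: power_divide)
    then have "ln ((norm x)\<^sup>2 / 4) = 2 * ln (norm x / 2)"
      using \<open>0 < norm x / 2\<close> by (simp add: ln_realpow)
    moreover have "0 < ln (norm x / 2)" using x by (intro ln_gt_zero) simp
    ultimately have "0 < sin (\<kappa> * ln ((norm x)\<^sup>2 / 4))"
      using \<kappa>(1) by (intro sin_gt_zero) (auto simp: field_simps)
    moreover have "(norm x)\<^sup>2 powr - \<mu> > 0" using x by auto
    ultimately show ?thesis unfolding S_def by simp
  qed
  have "continuous_on (cball y \<rho>) S"
    unfolding S_def by (intro continuous_intros) (use zero_notin in auto)
  then obtain z where z: "z \<in> cball y \<rho>" "\<And>x. x \<in> cball y \<rho> \<Longrightarrow> S z \<le> S x"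
    using continuous_attains_inf[OF compact_cball, of y \<rho> S] \<rho> by fastforce
  have large: "\<exists>t0\<ge>0. \<forall>t\<ge>t0. \<forall>x\<in>cball y \<rho>. B < u x t" for B
  proof -
    \<comment> \<open>The factor the exponential must reach. The maximum with 1 makes
      \<open>ln M \<ge> 0\<close>, so the waiting time \<open>1 + ln M / \<delta>\<close> is at
      least 1, where the growth bound is valid.\<close>
    define M where "M = max 1 (B / (c * S z))"
    have cS: "0 < c * S z" using c Spos[OF z(1)] by simp
    have "B < u x t" if t: "1 + ln M / \<delta> \<le> t" and x: "x \<in> cball y \<rho>" for x t
    proof -
      have M: "1 \<le> M" "B / (c * S z) \<le> M" by (auto simp: M_def)
      have "0 \<le> ln M / \<delta>" using M \<delta> by simp
      then have t1: "1 \<le> t" using t by simp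
      have "ln M \<le> \<delta> * (t - 1)" using t \<delta> by (simp add: field_simps)
      then have "exp (ln M) \<le> exp (\<delta> * (t - 1))" by (simp only: exp_le_cancel_iff)
      then have "M \<le> exp (\<delta> * (t - 1))" using M(1) by simp
      have "B \<le> M * (c * S z)" using M(2) cS by (simp add: pos_divide_le_eq)
      also have "\<dots> \<le> exp (\<delta> * (t - 1)) * (c * S x)"
        using \<open>M \<le> exp _\<close> z(2)[OF x] c Spos[OF z(1)] M(1) by (intro mult_mono) auto
      also have "\<dots> < u x t" using growth[of x t] ball[OF x] t1 by (simp add: ac_simps)
      finally show ?thesis .
    qed
    moreover have "0 \<le> 1 + ln M / \<delta>" using \<delta> by (simp add: M_def)
    ultimately show ?thesis by blast
  qed
  have "V x \<le> 0" if "x \<in> cball y \<rho>" for x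
  proof -
    have "V x \<le> \<omega> / (norm x)\<^sup>2" using V ball[OF that] by auto
    also have "\<dots> \<le> 0" using \<omega> by (simp add: divide_nonpos_nonneg)
    finally show ?thesis .
  qed
  moreover have "continuous_on (cball y \<rho>) a"
    by (rule locally_holder_on_imp_continuous_on[OF assms(4,2)]) auto
  ultimately show False
    using blowup[OF sol p \<rho> zero_notin] assms(5) large by blast
qed simp

end
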